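(* Let $B=B_0+B_1$, where $B_0,B_1$ are Banach spaces, let $X$ be a Banach space, and let $T$ be a linear operator, defined on $B$ with values in $X$, that maps $B_0$ continuously into $X$ with norm $\|T\|_0$. Then $T:B\to X$ is bounded, with norm $\|T\|$, if and only if $T:B_1\to X$ is bounded, with norm $\|T\|_1$; and in this case $$\|T\|=\max(\|T\|_0,\|T\|_1).$$
   Context: The sum $B_0+B_1$ of two Banach spaces (both continuously embedded in a common Hausdorff topological vector space) is the Banach space $\{f_0+f_1:f_i\in B_i\}$ with norm $\|f\|_{B_0+B_1}=\inf\{\|f_0\|_{B_0}+\|f_1\|_{B_1}: f=f_0+f_1,\ f_i\in B_i\}$. The norms $\|T\|_0$ and $\|T\|_1$ are the operator norms of the restrictions $T|_{B_0}:B_0\to X$ and $T|_{B_1}:B_1\to X$ with respect to $\|\cdot\|_{B_0}$ and $\|\cdot\|_{B_1}$. *)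

theory Defs
  imports "HOL-Analysis.Analysis"
begin

text \<open>Real topological vector spaces, not assumed Hausdorff: add \<open>t2_space\<close> for that.\<close>

class real_tvs = real_vector + topological_ab_group_add +
  assumes tendsto_scaleR_nhds:
    "((\<lambda>p. fst p *\<^sub>R snd p) \<longlongrightarrow> c *\<^sub>R x) (nhds c \<times>\<^sub>F nhds x)"

instance real_normed_vector \<subseteq> real_tvs
proof
  fix c :: real and x :: 'a
  show "((\<lambda>p. fst p *\<^sub>R snd p) \<longlongrightarrow> c *\<^sub>R x) (nhds c \<times>\<^sub>F nhds x)"
    by (intro tendsto_scaleR filterlim_fst filterlim_snd)
qed

text \<open>
  The spaces to be added are linear subspaces \<open>S\<close> of one ambient space, each carrying its own norm
  \<open>N\<close>; the values of \<open>N\<close> outside \<open>S\<close> are irrelevant.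
\<close>

definition norm_on :: "'v::real_vector set \<Rightarrow> ('v \<Rightarrow> real) \<Rightarrow> bool" where
  "norm_on S N \<longleftrightarrow> subspace S \<and>
     (\<forall>x\<in>S. 0 \<le> N x) \<and>
     (\<forall>x\<in>S. N x = 0 \<longleftrightarrow> x = 0) \<and>
     (\<forall>x\<in>S. \<forall>c. N (c *\<^sub>R x) = \<bar>c\<bar> * N x) \<and>
     (\<forall>x\<in>S. \<forall>y\<in>S. N (x + y) \<le> N x + N y)"

text \<open>
  \<^locale>\<open>Metric_space\<close> requires nonnegativity and symmetry also outside the carrier, hence the
  default value 0 there.
\<close>

definition norm_dist :: "'v::real_vector set \<Rightarrow> ('v \<Rightarrow> real) \<Rightarrow> 'v \<Rightarrow> 'v \<Rightarrow> real" where
  "norm_dist S N x y = (if x \<in> S \<and> y \<in> S then N (x - y) else 0)"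

lemma Metric_space_norm_dist:
  assumes "norm_on S N"
  shows "Metric_space S (norm_dist S N)"
proof
  have sub: "subspace S" and nn: "\<And>x. x \<in> S \<Longrightarrow> 0 \<le> N x"
    and z: "\<And>x. x \<in> S \<Longrightarrow> N x = 0 \<longleftrightarrow> x = 0"
    and sc: "\<And>x c. x \<in> S \<Longrightarrow> N (c *\<^sub>R x) = \<bar>c\<bar> * N x"
    and tr: "\<And>x y. x \<in> S \<Longrightarrow> y \<in> S \<Longrightarrow> N (x + y) \<le> N x + N y"
    using assms by (auto simp: norm_on_def)
  have diff: "x - y \<in> S" if "x \<in> S" "y \<in> S" for x y
    using sub that by (rule subspace_diff)
  show "0 \<le> norm_dist S N x y" for x y
    using nn diff by (simp add: norm_dist_def)
  show "norm_dist S N x y = norm_dist S N y x" for x y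
    using sc[OF diff, of x y "-1"] by (auto simp: norm_dist_def)
  show "norm_dist S N x y = 0 \<longleftrightarrow> x = y" if "x \<in> S" "y \<in> S" for x y
    using z[OF diff[OF that]] that by (simp add: norm_dist_def)
  show "norm_dist S N x w \<le> norm_dist S N x y + norm_dist S N y w"
    if "x \<in> S" "y \<in> S" "w \<in> S" for x y w
    using tr[OF diff diff, of x y y w] that by (simp add: norm_dist_def)
qed

abbreviation norm_topology :: "'v::real_vector set \<Rightarrow> ('v \<Rightarrow> real) \<Rightarrow> 'v topology" where
  "norm_topology S N \<equiv> Metric_space.mtopology S (norm_dist S N)"

definition banach_on :: "'v::real_vector set \<Rightarrow> ('v \<Rightarrow> real) \<Rightarrow> bool" where
  "banach_on S N \<longleftrightarrow> norm_on S N \<and> Metric_space.mcomplete S (norm_dist S N)"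

definition continuously_embedded ::
    "'v::{real_vector, topological_space} set \<Rightarrow> ('v \<Rightarrow> real) \<Rightarrow> bool" where
  "continuously_embedded S N \<longleftrightarrow> continuous_map (norm_topology S N) euclidean (\<lambda>x. x)"

text \<open>The norm of the sum space, whose carrier is the set sum \<open>S0 + S1\<close>.\<close>

definition sum_norm ::
    "'v::real_vector set \<Rightarrow> ('v \<Rightarrow> real) \<Rightarrow> 'v set \<Rightarrow> ('v \<Rightarrow> real) \<Rightarrow> 'v \<Rightarrow> real" where
  "sum_norm S0 N0 S1 N1 f =
     Inf {N0 f0 + N1 f1 | f0 f1. f0 \<in> S0 \<and> f1 \<in> S1 \<and> f = f0 + f1}"

definition linear_on_subspace ::
    "'v::real_vector set \<Rightarrow> ('v \<Rightarrow> 'x::real_vector) \<Rightarrow> bool" where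
  "linear_on_subspace S T \<longleftrightarrow>
     (\<forall>f\<in>S. \<forall>g\<in>S. T (f + g) = T f + T g) \<and> (\<forall>f\<in>S. \<forall>c. T (c *\<^sub>R f) = c *\<^sub>R T f)"

text \<open>
  Relative versions of the boundedness condition in \<^const>\<open>bounded_linear\<close> and of \<^const>\<open>onorm\<close>;
  as there, the convention \<open>x / 0 = 0\<close> disposes of the zero vector.
\<close>

definition bounded_op_on ::
    "'v set \<Rightarrow> ('v \<Rightarrow> real) \<Rightarrow> ('v \<Rightarrow> 'x::real_normed_vector) \<Rightarrow> bool" where
  "bounded_op_on S N T \<longleftrightarrow> (\<exists>K. \<forall>f\<in>S. norm (T f) \<le> N f * K)"

definition op_norm_on ::
    "'v set \<Rightarrow> ('v \<Rightarrow> real) \<Rightarrow> ('v \<Rightarrow> 'x::real_normed_vector) \<Rightarrow> real" where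
  "op_norm_on S N T = (SUP f\<in>S. norm (T f) / N f)"

end

theory Submission
  imports Defs
begin

text \<open>
  For \<open>M \<ge> 0\<close>, the estimate \<open>norm (T f) \<le> M * N f\<close> on the sum is equivalent to the estimates with the
  same constant \<open>M\<close> and the norms \<open>N0\<close> and \<open>N1\<close> on the summands.
  Given the estimates on the summands, every decomposition \<open>f = f0 + f1\<close> yields
  \<open>norm (T f) \<le> M * (N0 f0 + N1 f1)\<close>, and one takes the infimum
  (\<open>le_mult_sum_norm\<close>). Conversely, the trivial decompositions \<open>f = f + 0\<close> and \<open>f = 0 + f\<close> show that
  the sum norm is at most \<open>N0\<close> on \<open>B0\<close> and at most \<open>N1\<close> on \<open>B1\<close> (\<open>sum_norm_le_left\<close>,
  \<open>sum_norm_le_right\<close>). As an operator norm is the least nonnegative constant in such an estimate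
  (\<open>norm_le_op_norm_on\<close>, \<open>op_norm_on_least\<close>), the formula for the norm of \<open>T\<close> follows. Continuity on
  \<open>B0\<close> enters only as boundedness (\<open>bounded_op_on_if_continuous_map\<close>).
\<close>

lemma norm_on_zero:
  assumes "norm_on S N"
  shows "0 \<in> S" and "N 0 = 0"
  using assms subspace_0 by (auto simp: norm_on_def)

lemma norm_on_nonneg:
  assumes "norm_on S N" and "x \<in> S"
  shows "0 \<le> N x"
  using assms by (simp add: norm_on_def)

lemma linear_on_subspace_mono:
  assumes "linear_on_subspace S T" and "R \<subseteq> S"
  shows "linear_on_subspace R T"
  using assms unfolding linear_on_subspace_def by blast

text \<open>
  For a bounded operator the quotients in the operator norm are bounded above, including those that
  are 0 because \<open>N\<close> vanishes, so their supremum is not a default value.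
\<close>

lemma norm_quotient_le_op_norm_on:
  assumes bdd: "bounded_op_on S N T"
    and nonneg: "\<And>f. f \<in> S \<Longrightarrow> 0 \<le> N f"
    and f: "f \<in> S"
  shows "norm (T f) / N f \<le> op_norm_on S N T"
proof -
  obtain K where K: "\<And>g. g \<in> S \<Longrightarrow> norm (T g) \<le> N g * K"
    using bdd by (auto simp: bounded_op_on_def)
  have "norm (T g) / N g \<le> max 0 K" if "g \<in> S" for g
  proof (cases "N g = 0")
    case False
    then have "norm (T g) / N g \<le> K"
      using K[OF that] nonneg[OF that] by (simp add: pos_divide_le_eq mult.commute)
    then show ?thesis
      by simp
  qed simp
  then have "bdd_above ((\<lambda>g. norm (T g) / N g) ` S)"
    by (auto intro!: bdd_aboveI2)
  then show ?thesis
    unfolding op_norm_on_def using f by (intro cSUP_upper)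
qed

lemma op_norm_on_nonneg:
  assumes "bounded_op_on S N T" and nonneg: "\<And>f. f \<in> S \<Longrightarrow> 0 \<le> N f" and "S \<noteq> {}"
  shows "0 \<le> op_norm_on S N T"
proof -
  obtain f where f: "f \<in> S"
    using \<open>S \<noteq> {}\<close> by blast
  then have "0 \<le> norm (T f) / N f"
    using nonneg by simp
  also have "\<dots> \<le> op_norm_on S N T"
    using assms(1) nonneg f by (rule norm_quotient_le_op_norm_on)
  finally show ?thesis .
qed

text \<open>
  The next two lemmas characterize the operator norm as the least nonnegative admissible constant.
  They need only a nonnegative \<open>N\<close>, so that the sum norm need not be shown to be definite: where \<open>N\<close>
  vanishes, boundedness forces \<open>T f = 0\<close>.
\<close>

lemma norm_le_op_norm_on:
  assumes bdd: "bounded_op_on S N T"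
    and nonneg: "\<And>f. f \<in> S \<Longrightarrow> 0 \<le> N f"
    and f: "f \<in> S"
  shows "norm (T f) \<le> op_norm_on S N T * N f"
proof (cases "N f = 0")
  case True
  then show ?thesis
    using bdd f by (auto simp: bounded_op_on_def)
next
  case False
  then show ?thesis
    using norm_quotient_le_op_norm_on[OF assms] nonneg[OF f] by (simp add: pos_divide_le_eq)
qed

lemma op_norm_on_least:
  assumes "S \<noteq> {}" and "0 \<le> M"
    and nonneg: "\<And>f. f \<in> S \<Longrightarrow> 0 \<le> N f"
    and bound: "\<And>f. f \<in> S \<Longrightarrow> norm (T f) \<le> M * N f"
  shows "op_norm_on S N T \<le> M"
  unfolding op_norm_on_def
proof (rule cSUP_least)
  fix f assume "f \<in> S"
  then show "norm (T f) / N f \<le> M"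
    using nonneg[of f] bound[of f] \<open>0 \<le> M\<close>
    by (cases "N f = 0") (auto simp: field_simps)
qed fact

lemma bounded_op_on_if_continuous_map:
  assumes norm: "norm_on S N"
    and lin: "linear_on_subspace S T"
    and cont: "continuous_map (norm_topology S N) euclidean T"
  shows "bounded_op_on S N T"
proof -
  interpret Metric_space S "norm_dist S N"
    using norm by (rule Metric_space_norm_dist)
  note zero = norm_on_zero[OF norm]
  have scale: "T (c *\<^sub>R f) = c *\<^sub>R T f" if "f \<in> S" for c f
    using lin that by (auto simp: linear_on_subspace_def)
  have T0: "T 0 = 0"
    using scale[OF zero(1), of 0] by simp
  have "openin mtopology {f \<in> topspace mtopology. T f \<in> ball 0 1}"
    using cont by (rule openin_continuous_map_preimage) simp
  then obtain r where r: "r > 0" and sub: "mball 0 r \<subseteq> {f \<in> S. T f \<in> ball 0 1}"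
    using zero T0 by (auto simp: openin_mtopology)
  have "norm (T f) \<le> N f * (2 / r)" if f: "f \<in> S" for f
  proof (cases "N f = 0")
    case True
    then have "f = 0"
      using norm f by (auto simp: norm_on_def)
    then show ?thesis
      using T0 zero by simp
  next
    case False
    then have pos: "N f > 0"
      using norm_on_nonneg[OF norm f] by simp
    \<comment> \<open>Rescale \<open>f\<close> to norm \<open>r / 2\<close>, inside the ball on which \<open>T\<close> is bounded by 1.\<close>
    define c where "c = r / (2 * N f)"
    have c: "c > 0"
      using r pos by (simp add: c_def)
    have cf: "c *\<^sub>R f \<in> S" "- (c *\<^sub>R f) \<in> S"
      using norm f by (auto simp: norm_on_def subspace_scale subspace_neg)
    have "N ((- c) *\<^sub>R f) = \<bar>- c\<bar> * N f"
      using norm f unfolding norm_on_def by blast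
    then have "N (- (c *\<^sub>R f)) = r / 2"
      using r pos by (simp add: c_def)
    then have "c *\<^sub>R f \<in> mball 0 r"
      using cf zero r by (simp add: norm_dist_def)
    then have "norm (T (c *\<^sub>R f)) < 1"
      using sub by auto
    then have "c * norm (T f) < 1"
      using scale[OF f] c by simp
    then show ?thesis
      using r pos by (simp add: c_def field_simps)
  qed
  then show ?thesis
    unfolding bounded_op_on_def by blast
qed

lemma sum_norm_le:
  assumes "norm_on S0 N0" and "norm_on S1 N1" and "f0 \<in> S0" and "f1 \<in> S1"
  shows "sum_norm S0 N0 S1 N1 (f0 + f1) \<le> N0 f0 + N1 f1"
  unfolding sum_norm_def
proof (rule cInf_lower)
  show "bdd_below {N0 g0 + N1 g1 | g0 g1. g0 \<in> S0 \<and> g1 \<in> S1 \<and> f0 + f1 = g0 + g1}"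
    by (rule bdd_belowI[where m = 0])
      (use norm_on_nonneg[OF assms(1)] norm_on_nonneg[OF assms(2)] in auto)
qed (use assms in blast)

lemma sum_norm_le_left:
  assumes "norm_on S0 N0" and "norm_on S1 N1" and "f \<in> S0"
  shows "sum_norm S0 N0 S1 N1 f \<le> N0 f"
  using sum_norm_le[OF assms norm_on_zero(1)[OF assms(2)]] norm_on_zero(2)[OF assms(2)] by simp

lemma sum_norm_le_right:
  assumes "norm_on S0 N0" and "norm_on S1 N1" and "f \<in> S1"
  shows "sum_norm S0 N0 S1 N1 f \<le> N1 f"
  using sum_norm_le[OF assms(1,2) norm_on_zero(1)[OF assms(1)] assms(3)]
    norm_on_zero(2)[OF assms(1)] by simp

lemma le_mult_sum_norm:
  assumes "f \<in> S0 + S1" and "0 \<le> M"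
    and le: "\<And>f0 f1. f0 \<in> S0 \<Longrightarrow> f1 \<in> S1 \<Longrightarrow> f = f0 + f1 \<Longrightarrow> c \<le> M * (N0 f0 + N1 f1)"
  shows "c \<le> M * sum_norm S0 N0 S1 N1 f"
proof (cases "M = 0")
  case True
  then show ?thesis
    using assms by (auto elim!: set_plus_elim)
next
  case False
  then have "M > 0"
    using \<open>0 \<le> M\<close> by simp
  have "c / M \<le> sum_norm S0 N0 S1 N1 f"
    unfolding sum_norm_def
  proof (rule cInf_greatest)
    show "{N0 f0 + N1 f1 | f0 f1. f0 \<in> S0 \<and> f1 \<in> S1 \<and> f = f0 + f1} \<noteq> {}"
      using assms(1) by (auto elim!: set_plus_elim)
  next
    fix x assume "x \<in> {N0 f0 + N1 f1 | f0 f1. f0 \<in> S0 \<and> f1 \<in> S1 \<and> f = f0 + f1}"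
    then show "c / M \<le> x"
      using le \<open>M > 0\<close> by (auto simp: pos_divide_le_eq mult.commute)
  qed
  then show ?thesis
    using \<open>M > 0\<close> by (simp add: pos_divide_le_eq mult.commute)
qed

lemma sum_norm_nonneg:
  assumes "norm_on S0 N0" and "norm_on S1 N1" and "f \<in> S0 + S1"
  shows "0 \<le> sum_norm S0 N0 S1 N1 f"
  using le_mult_sum_norm[OF assms(3), where M = 1 and c = 0] assms(1,2)
  by (simp add: norm_on_nonneg)

lemma norm_le_mult_sum_norm:
  assumes lin: "linear_on_subspace (S0 + S1) T"
    and norms: "norm_on S0 N0" "norm_on S1 N1"
    and M: "0 \<le> M"
    and bound: "\<And>f. f \<in> S0 \<Longrightarrow> norm (T f) \<le> M * N0 f" "\<And>f. f \<in> S1 \<Longrightarrow> norm (T f) \<le> M * N1 f"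
    and f: "f \<in> S0 + S1"
  shows "norm (T f) \<le> M * sum_norm S0 N0 S1 N1 f"
proof (rule le_mult_sum_norm[OF f M])
  fix f0 f1 assume f01: "f0 \<in> S0" "f1 \<in> S1" "f = f0 + f1"
  have "f0 \<in> S0 + S1" "f1 \<in> S0 + S1"
    using set_plus_intro[OF f01(1) norm_on_zero(1)[OF norms(2)]]
      set_plus_intro[OF norm_on_zero(1)[OF norms(1)] f01(2)] by simp_all
  then have "T f = T f0 + T f1"
    using lin f01(3) by (simp add: linear_on_subspace_def)
  then have "norm (T f) \<le> norm (T f0) + norm (T f1)"
    by (simp add: norm_triangle_ineq)
  also have "\<dots> \<le> M * (N0 f0 + N1 f1)"
    using bound(1)[OF f01(1)] bound(2)[OF f01(2)] by (simp add: distrib_left)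
  finally show "norm (T f) \<le> M * (N0 f0 + N1 f1)" .
qed

theorem proposition2p4:
  fixes B0 B1 :: "'v::{real_tvs, t2_space} set"
    and N0 N1 :: "'v \<Rightarrow> real"
    and T :: "'v \<Rightarrow> 'x::banach"
  defines "B \<equiv> B0 + B1"
    and "N \<equiv> sum_norm B0 N0 B1 N1"
  assumes "banach_on B0 N0" and "continuously_embedded B0 N0"
    and "banach_on B1 N1" and "continuously_embedded B1 N1"
    and "linear_on_subspace B T"
    and "continuous_map (norm_topology B0 N0) euclidean T"
  shows "(bounded_op_on B N T \<longleftrightarrow> bounded_op_on B1 N1 T) \<and>
    (bounded_op_on B N T \<longrightarrow>
       op_norm_on B N T = max (op_norm_on B0 N0 T) (op_norm_on B1 N1 T))"
proof -
  have n0: "norm_on B0 N0" and n1: "norm_on B1 N1"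
    using assms by (auto simp: banach_on_def)
  note zero = norm_on_zero[OF n0] norm_on_zero[OF n1]
  have lin: "linear_on_subspace (B0 + B1) T"
    using assms by simp
  have sub0: "B0 \<subseteq> B" and sub1: "B1 \<subseteq> B"
    using set_zero_plus2[of B1 B0] set_zero_plus2[of B0 B1] zero
    by (simp_all add: B_def add.commute)
  have ne: "B0 \<noteq> {}" "B1 \<noteq> {}" "B \<noteq> {}"
    using zero sub0 by auto
  have N_nonneg: "0 \<le> N f" if "f \<in> B" for f
    using sum_norm_nonneg[OF n0 n1] that by (simp add: B_def N_def)
  have N_le: "f \<in> B0 \<Longrightarrow> N f \<le> N0 f" "f \<in> B1 \<Longrightarrow> N f \<le> N1 f" for f
    using sum_norm_le_left[OF n0 n1] sum_norm_le_right[OF n0 n1] by (simp_all add: N_def)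
  have bdd0: "bounded_op_on B0 N0 T"
    using n0 linear_on_subspace_mono[OF assms(7) sub0] assms(8)
    by (rule bounded_op_on_if_continuous_map)
  define M where "M = max (op_norm_on B0 N0 T) (op_norm_on B1 N1 T)"
  have M_nonneg: "0 \<le> M"
    using op_norm_on_nonneg[OF bdd0 norm_on_nonneg[OF n0] ne(1)] by (simp add: M_def)
  have upper: "norm (T f) \<le> M * N f" if bdd1: "bounded_op_on B1 N1 T" and "f \<in> B" for f
    unfolding N_def
  proof (rule norm_le_mult_sum_norm[OF lin n0 n1 M_nonneg])
    show "norm (T g) \<le> M * N0 g" if g: "g \<in> B0" for g
    proof -
      have "norm (T g) \<le> op_norm_on B0 N0 T * N0 g"
        using bdd0 norm_on_nonneg[OF n0] g by (rule norm_le_op_norm_on)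
      also have "\<dots> \<le> M * N0 g"
        by (intro mult_right_mono norm_on_nonneg[OF n0 g]) (simp add: M_def)
      finally show ?thesis .
    qed
    show "norm (T g) \<le> M * N1 g" if g: "g \<in> B1" for g
    proof -
      have "norm (T g) \<le> op_norm_on B1 N1 T * N1 g"
        using bdd1 norm_on_nonneg[OF n1] g by (rule norm_le_op_norm_on)
      also have "\<dots> \<le> M * N1 g"
        by (intro mult_right_mono norm_on_nonneg[OF n1 g]) (simp add: M_def)
      finally show ?thesis .
    qed
  qed (use that in \<open>simp add: B_def\<close>)
  show ?thesis
  proof (intro conjI iffI impI)
    assume bdd1: "bounded_op_on B1 N1 T"
    show "bounded_op_on B N T"
      unfolding bounded_op_on_def using upper[OF bdd1] by (intro exI[of _ M]) (simp add: mult.commute)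
  next
    assume bdd: "bounded_op_on B N T"
    define C where "C = op_norm_on B N T"
    have C_nonneg: "0 \<le> C"
      unfolding C_def using bdd N_nonneg ne(3) by (rule op_norm_on_nonneg)
    have C: "norm (T f) \<le> C * N f" if "f \<in> B" for f
      unfolding C_def using bdd N_nonneg that by (rule norm_le_op_norm_on)
    have C0: "norm (T f) \<le> C * N0 f" if "f \<in> B0" for f
      using C[of f] mult_left_mono[OF N_le(1)[OF that] C_nonneg] sub0 that by auto
    have C1: "norm (T f) \<le> C * N1 f" if "f \<in> B1" for f
      using C[of f] mult_left_mono[OF N_le(2)[OF that] C_nonneg] sub1 that by auto
    show bdd1: "bounded_op_on B1 N1 T"
      unfolding bounded_op_on_def using C1 by (intro exI[of _ C]) (simp add: mult.commute)
    have "C \<le> M"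
      unfolding C_def using ne(3) M_nonneg N_nonneg upper[OF bdd1] by (rule op_norm_on_least)
    moreover have "op_norm_on B0 N0 T \<le> C"
      using ne(1) C_nonneg norm_on_nonneg[OF n0] C0 by (rule op_norm_on_least)
    moreover have "op_norm_on B1 N1 T \<le> C"
      using ne(2) C_nonneg norm_on_nonneg[OF n1] C1 by (rule op_norm_on_least)
    ultimately show "op_norm_on B N T = max (op_norm_on B0 N0 T) (op_norm_on B1 N1 T)"
      by (simp add: C_def M_def)
  qed
qed

end
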